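(* Let $k\in\{0,\dots,n-1\}$ and let $\Gamma_k=\{x_k^1,\dots,x_k^{N_k}\}$ and $\Gamma_{k+1}=\{x_{k+1}^1<\dots<x_{k+1}^{N_{k+1}}\}$ be finite grids of $\mathbb{R}$. Let $\widehat X_k=\mathrm{Proj}_{\Gamma_k}(\widetilde X_k)$ and $$\widetilde X_{k+1}=\mu_k(J,\widehat X_k)+v_k(J,\widehat X_k)\,\xi_{k+1}$$ be one step of the recursive quantization of the Euler scheme of a jump diffusion with $\mathcal{N}(\mu,\vartheta^2)$-distributed jump sizes and at most one jump per time step (see context), and let $p_k^i=\mathbb{P}(\widehat X_k=x_k^i)=\mathbb{P}(\widetilde X_k\in C_i(\Gamma_k))$. Then: (i) for every $i\in\{1,\dots,N_k\}$ (with $p_k^i>0$) and every $j\in\{1,\dots,N_{k+1}\}$, the transition probability $p_k^{ij}=\mathbb{P}\big(\widetilde X_{k+1}\in C_j(\Gamma_{k+1})\mid\widetilde X_k\in C_i(\Gamma_k)\big)$ is given by $$p_k^{ij}=\sum_{m=0}^1p_m\Big(\Phi_0\big(x_{k+1}^{j+}(m,x_k^i)\big)-\Phi_0\big(x_{k+1}^{j-}(m,x_k^i)\big)\Big);$$ (ii) for every $j\in\{1,\dots,N_{k+1}\}$, the probability $p_{k+1}^j=\mathbb{P}\big(\widetilde X_{k+1}\in C_j(\Gamma_{k+1})\big)$ is given by $$p_{k+1}^j=\sum_{i=1}^{N_k}\sum_{m=0}^1p_k^i\,p_m\Big(\Phi_0\big(x_{k+1}^{j+}(m,x_k^i)\big)-\Phi_0\big(x_{k+1}^{j-}(m,x_k^i)\big)\Big),$$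 where $p_0=1-\lambda h$ and $p_1=\lambda h$.
   Context: $\Phi_0$ is the cumulative distribution function of $\mathcal{N}(0,1)$, with $\Phi_0(-\infty)=0$, $\Phi_0(+\infty)=1$. $\mathrm{Proj}_\Gamma$ is a Borel nearest-neighbour projection onto the finite grid $\Gamma$ and $C_i(\Gamma)=\mathrm{Proj}_\Gamma^{-1}(\{x_i\})$ is the corresponding Voronoi cell of its $i$-th point. One-dimensional setting: $h>0$, $\lambda>0$ with $\lambda h\in(0,1)$, $t_k=kh$, $b,\sigma:[0,T]\times\mathbb{R}\to\mathbb{R}$ and $\gamma:\mathbb{R}\to\mathbb{R}$ are the drift, diffusion and jump coefficients, $\mu\in\mathbb{R}$, $\vartheta\ge 0$. $J$ is a Bernoulli variable (number of jumps in the time step) with $\mathbb{P}(J=1)=\lambda h$, $\mathbb{P}(J=0)=1-\lambda h$; $\xi_{k+1}\sim\mathcal{N}(0,1)$; $J$, $\xi_{k+1}$ and $\widetilde X_k$ are independent. For $m\in\{0,1\}$ and $x\in\mathbb{R}$, $$\mu_k(m,x)=x+h\,b(t_k,x)+\mu(m-\lambda h)\gamma(x),\qquad v_k(m,x)=\sqrt{h\,\sigma^2(t_k,x)+m\,\vartheta^2\gamma^2(x)},$$ and $v_k(m,x_k^i)>0$ for all $m\in\{0,1\}$ and $i$. For $j=1,\dots,N_{k+1}$: $x_{k+1}^{j-1/2}=\frac{x_{k+1}^j+x_{k+1}^{j-1}}2$, $x_{k+1}^{j+1/2}=\frac{x_{k+1}^j+x_{k+1}^{j+1}}2$, with $x_{k+1}^{1/2}=-\infty$,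 $x_{k+1}^{N_{k+1}+1/2}=+\infty$, and $$x_{k+1}^{j-}(m,x)=\frac{x_{k+1}^{j-1/2}-\mu_k(m,x)}{v_k(m,x)},\qquad x_{k+1}^{j+}(m,x)=\frac{x_{k+1}^{j+1/2}-\mu_k(m,x)}{v_k(m,x)}.$$ *)

theory Defs
  imports "HOL-Probability.Probability"
begin

definition Phi0 :: "ereal \<Rightarrow> real" where
  "Phi0 z = (if z = -\<infinity> then 0 else if z = \<infinity> then 1
             else cdf std_normal_distribution (real_of_ereal z))"

text \<open>The tie-breaking rule of a nearest-neighbour projection is left open: any Borel
  selection of a nearest point is admitted. The condition forces the grid to be nonempty.\<close>

definition nearest_proj :: "real set \<Rightarrow> (real \<Rightarrow> real) \<Rightarrow> bool" where
  "nearest_proj \<Gamma> P \<longleftrightarrow>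
     P \<in> borel_measurable borel \<and> (\<forall>y. P y \<in> \<Gamma> \<and> (\<forall>z\<in>\<Gamma>. \<bar>y - P y\<bar> \<le> \<bar>y - z\<bar>))"

definition voronoi_cell :: "(real \<Rightarrow> real) \<Rightarrow> (nat \<Rightarrow> real) \<Rightarrow> nat \<Rightarrow> real set" where
  "voronoi_cell P x i = P -` {x i}"

definition step_mean ::
  "(real \<Rightarrow> real \<Rightarrow> real) \<Rightarrow> (real \<Rightarrow> real) \<Rightarrow> real \<Rightarrow> real \<Rightarrow> real \<Rightarrow> nat \<Rightarrow> nat \<Rightarrow> real \<Rightarrow> real" where
  "step_mean b \<gamma> \<mu> lam h k m x =
     x + h * b (real k * h) x + \<mu> * (real m - lam * h) * \<gamma> x"

definition step_sd ::
  "(real \<Rightarrow> real \<Rightarrow> real) \<Rightarrow> (real \<Rightarrow> real) \<Rightarrow> real \<Rightarrow> real \<Rightarrow> nat \<Rightarrow> nat \<Rightarrow> real \<Rightarrow> real" where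
  "step_sd \<sigma> \<gamma> \<theta> h k m x =
     sqrt (h * (\<sigma> (real k * h) x)\<^sup>2 + real m * \<theta>\<^sup>2 * (\<gamma> x)\<^sup>2)"

text \<open>Grids are indexed by 1..N; the outermost midpoints are infinite.\<close>

definition lower_mid :: "(nat \<Rightarrow> real) \<Rightarrow> nat \<Rightarrow> ereal" where
  "lower_mid x j = (if j = 1 then -\<infinity> else ereal ((x j + x (j - 1)) / 2))"

definition upper_mid :: "nat \<Rightarrow> (nat \<Rightarrow> real) \<Rightarrow> nat \<Rightarrow> ereal" where
  "upper_mid N x j = (if j = N then \<infinity> else ereal ((x j + x (j + 1)) / 2))"

definition standardize :: "ereal \<Rightarrow> real \<Rightarrow> real \<Rightarrow> ereal" where
  "standardize z c s = (z - ereal c) / ereal s"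

definition jump_prob :: "real \<Rightarrow> real \<Rightarrow> nat \<Rightarrow> real" where
  "jump_prob lam h m = (if m = 0 then 1 - lam * h else lam * h)"

end

theory Submission
  imports Defs
begin

text \<open>On the event that \<open>J\<close> equals m and \<open>Xhat\<close> equals
  \<open>x i\<close>, the mean and standard deviation of the step are constants c and s, and
  independence leaves \<open>\<xi>\<close> standard normal there. So the new state falls in a cell
  exactly when c + s * \<open>\<xi>\<close> does. On an ordered grid the j-th cell is the interval
  between the two midpoints around \<open>x' j\<close>, up to its endpoints, which are null for a
  Gaussian law; after standardizing, its probability is a difference of \<open>Phi0\<close> values
  (\<open>measure_std_normal_voronoi_cell\<close>).

  Weighting by the law of \<open>J\<close> gives the joint probability of the new cell and the old
  grid point (\<open>prob_mixture_step\<close>). Dividing it by \<open>p i\<close> yields the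
  transition probability; summing it over i yields the marginal one.\<close>

section \<open>Voronoi cells of an ordered grid as intervals between midpoints\<close>

text \<open>Only the two neighbours of \<open>x j\<close> have to be compared with it. The
  inequalities are weak because a midpoint is a tie, which \<open>P\<close> may resolve either
  way.\<close>

lemma nearest_proj_eq_imp_between_mids:
  assumes mono: "strict_mono_on {1..N} x" and P: "nearest_proj (x ` {1..N}) P"
    and j: "j \<in> {1..N}" and y: "P y = x j"
  shows "lower_mid x j \<le> ereal y" and "ereal y \<le> upper_mid N x j"
proof -
  have near: "\<bar>y - x j\<bar> \<le> \<bar>y - x i\<bar>" if "i \<in> {1..N}" for i
    using P y that unfolding nearest_proj_def by (metis imageI)
  show "lower_mid x j \<le> ereal y"
  proof (cases "j = 1")
    case False
    then have "j - 1 \<in> {1..N}" "j - 1 < j" using j by auto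
    then have "x (j - 1) < x j" "\<bar>y - x j\<bar> \<le> \<bar>y - x (j - 1)\<bar>"
      using near j by (blast intro: strict_mono_onD[OF mono])+
    then have "(x j + x (j - 1)) / 2 \<le> y" by (simp add: abs_if field_simps split: if_splits)
    then show ?thesis using False by (simp add: lower_mid_def)
  qed (simp add: lower_mid_def)
  show "ereal y \<le> upper_mid N x j"
  proof (cases "j = N")
    case False
    then have "j + 1 \<in> {1..N}" using j by auto
    then have "x j < x (j + 1)" "\<bar>y - x j\<bar> \<le> \<bar>y - x (j + 1)\<bar>"
      using near j strict_mono_onD[OF mono, of j "j + 1"] by simp_all
    then have "y \<le> (x j + x (j + 1)) / 2" by (simp add: abs_if field_simps split: if_splits)
    then show ?thesis using False by (simp add: upper_mid_def)
  qed (simp add: upper_mid_def)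
qed

text \<open>A selected point \<open>x i\<close> left of \<open>x j\<close> lies at or left of the
  neighbour \<open>x (j - 1)\<close>, so a y beyond the midpoint of that neighbour and
  \<open>x j\<close> is strictly nearer to \<open>x j\<close>, a contradiction; the right side is
  symmetric.\<close>

lemma strictly_between_mids_imp_nearest_proj_eq:
  assumes mono: "strict_mono_on {1..N} x" and P: "nearest_proj (x ` {1..N}) P"
    and j: "j \<in> {1..N}" and l: "lower_mid x j < ereal y" and u: "ereal y < upper_mid N x j"
  shows "P y = x j"
proof -
  obtain i where i: "i \<in> {1..N}" "P y = x i"
    using P unfolding nearest_proj_def by (metis imageE)
  have xm: "x a \<le> x c" if "a \<in> {1..N}" "c \<in> {1..N}" "a \<le> c" for a c
    using mono that by (rule strict_mono_on_leD)
  have near: "\<bar>y - x i\<bar> \<le> \<bar>y - x j\<bar>"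
    using P i j unfolding nearest_proj_def by (metis imageI)
  have "\<not> i < j"
  proof
    assume "i < j"
    \<comment> \<open>Having a grid point to the left excludes the case of an infinite
      \<open>lower_mid\<close>.\<close>
    then have "j \<noteq> 1" "i \<le> j - 1" "j - 1 \<in> {1..N}" "j - 1 < j" using i j by auto
    moreover from this have "x i \<le> x (j - 1)" "(x j + x (j - 1)) / 2 < y"
      using xm i(1) l by (simp_all add: lower_mid_def)
    moreover have "x i < x j"
      using strict_mono_onD[OF mono i(1) j \<open>i < j\<close>] .
    ultimately show False using near by (simp add: abs_if field_simps split: if_splits)
  qed
  moreover have "\<not> j < i"
  proof
    assume "j < i"
    then have "j \<noteq> N" "j + 1 \<le> i" "j + 1 \<in> {1..N}" using i j by auto
    moreover from this have "x (j + 1) \<le> x i" "y < (x j + x (j + 1)) / 2"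
      using xm i(1) u by (simp_all add: upper_mid_def)
    moreover have "x j < x i"
      using strict_mono_onD[OF mono j i(1) \<open>j < i\<close>] .
    ultimately show False using near by (simp add: abs_if field_simps split: if_splits)
  qed
  ultimately show ?thesis using i by (metis linorder_neqE_nat)
qed

lemma lower_mid_le_upper_mid:
  assumes mono: "strict_mono_on {1..N} x" and j: "j \<in> {1..N}"
  shows "lower_mid x j \<le> upper_mid N x j"
proof (cases "j = 1 \<or> j = N")
  case False
  then have "j - 1 \<in> {1..N}" "j - 1 < j" "j + 1 \<in> {1..N}"
    using j by auto
  then have "x (j - 1) < x j" "x j < x (j + 1)"
    using j strict_mono_onD[OF mono, of "j - 1" j] strict_mono_onD[OF mono, of j "j + 1"] by simp_all
  then show ?thesis using False by (simp add: lower_mid_def upper_mid_def)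
qed (auto simp: lower_mid_def upper_mid_def)

section \<open>Gaussian probabilities of standardized intervals\<close>

text \<open>The increasing affine map z to c + s * z can be inverted inside the inequality; infinite
  midpoints are covered, since \<open>standardize\<close> leaves them unchanged for positive
  s.\<close>

lemma standardize_less_iff:
  assumes "s > 0"
  shows "standardize u c s < ereal z \<longleftrightarrow> u < ereal (c + s * z)"
    and "ereal z < standardize u c s \<longleftrightarrow> ereal (c + s * z) < u"
  using assms by (cases u; simp add: standardize_def field_simps)+

lemma standardize_mono:
  assumes "s > 0" "u \<le> v"
  shows "standardize u c s \<le> standardize v c s"
  using assms unfolding standardize_def
  by (intro ereal_divide_right_mono ereal_minus_mono) auto

text \<open>The conventions at the infinities become the masses of the empty set and of the whole
  line, so no later argument has to treat the outermost cells separately.\<close>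

lemma Phi0_eq_measure: "Phi0 a = measure std_normal_distribution {z. ereal z \<le> a}"
proof (cases a)
  case (real r)
  then show ?thesis by (simp add: Phi0_def cdf_def atMost_def)
next
  case PInf
  interpret prob_space std_normal_distribution
    by (rule prob_space_normal_density) simp
  show ?thesis using PInf prob_space by (simp add: Phi0_def)
qed (simp add: Phi0_def)

lemma AE_std_normal_neq: "AE z in std_normal_distribution. ereal z \<noteq> a"
proof -
  have "AE z in lborel. ereal z \<noteq> a"
    by (cases a) (auto intro: AE_lborel_singleton)
  then show ?thesis by (auto simp: AE_density)
qed

text \<open>The normal law has no atoms, so it does not matter which of the endpoints belong to
  \<open>S\<close>; for Voronoi cells this makes the tie-breaking rule irrelevant.\<close>

lemma measure_std_normal_interval:
  assumes S: "S \<in> sets borel" and ab: "a \<le> b"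
    and inner: "\<And>z. a < ereal z \<Longrightarrow> ereal z < b \<Longrightarrow> z \<in> S"
    and outer: "\<And>z. z \<in> S \<Longrightarrow> a \<le> ereal z \<and> ereal z \<le> b"
  shows "measure std_normal_distribution S = Phi0 b - Phi0 a"
proof -
  interpret prob_space std_normal_distribution
    by (rule prob_space_normal_density) simp
  \<comment> \<open>A half-open interval is used because it is a difference of two half-lines,
    nested by a \<le> b, whose masses are \<open>Phi0\<close> values.\<close>
  have "measure std_normal_distribution S
      = measure std_normal_distribution ({z. ereal z \<le> b} - {z. ereal z \<le> a})"
  proof (rule finite_measure_eq_AE)
    show "AE z in std_normal_distribution. z \<in> S \<longleftrightarrow> z \<in> {z. ereal z \<le> b} - {z. ereal z \<le> a}"
      using AE_std_normal_neq[of a] AE_std_normal_neq[of b]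
    proof eventually_elim
      case (elim z)
      then show ?case using inner[of z] outer[of z] by (auto simp: not_le less_le)
    qed
  qed (use S in auto)
  also have "\<dots> = Phi0 b - Phi0 a"
    unfolding Phi0_eq_measure using ab by (intro finite_measure_Diff) auto
  finally show ?thesis .
qed

lemma voronoi_cell_measurable:
  assumes "nearest_proj \<Gamma> P"
  shows "voronoi_cell P x j \<in> sets borel"
proof -
  have "P -` {x j} \<inter> space borel \<in> sets borel"
    using assms unfolding nearest_proj_def by (intro measurable_sets) auto
  then show ?thesis by (simp add: voronoi_cell_def)
qed

text \<open>The preimage of the cell under z to c + s * z is sandwiched between the open and the
  closed interval with the standardized midpoints as endpoints.\<close>

lemma measure_std_normal_voronoi_cell:
  assumes mono: "strict_mono_on {1..N} x" and P: "nearest_proj (x ` {1..N}) P"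
    and j: "j \<in> {1..N}" and s: "s > 0"
  shows "measure std_normal_distribution {z. c + s * z \<in> voronoi_cell P x j}
    = Phi0 (standardize (upper_mid N x j) c s) - Phi0 (standardize (lower_mid x j) c s)"
proof (rule measure_std_normal_interval)
  have [measurable]: "voronoi_cell P x j \<in> sets borel"
    by (rule voronoi_cell_measurable[OF P])
  show "{z. c + s * z \<in> voronoi_cell P x j} \<in> sets borel" by measurable
  show "standardize (lower_mid x j) c s \<le> standardize (upper_mid N x j) c s"
    by (intro standardize_mono lower_mid_le_upper_mid mono j s)
next
  fix z
  assume "standardize (lower_mid x j) c s < ereal z" "ereal z < standardize (upper_mid N x j) c s"
  then show "z \<in> {z. c + s * z \<in> voronoi_cell P x j}"
    using strictly_between_mids_imp_nearest_proj_eq[OF mono P j]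
    by (auto simp: standardize_less_iff[OF s] voronoi_cell_def)
next
  fix z
  assume "z \<in> {z. c + s * z \<in> voronoi_cell P x j}"
  then have "P (c + s * z) = x j" by (simp add: voronoi_cell_def)
  from nearest_proj_eq_imp_between_mids[OF mono P j this]
  show "standardize (lower_mid x j) c s \<le> ereal z \<and> ereal z \<le> standardize (upper_mid N x j) c s"
    \<comment> \<open>The weak bounds follow by negating the strict equivalences.\<close>
    by (simp add: standardize_less_iff[OF s] flip: not_less)
qed

section \<open>Independence and the law of one step\<close>

text \<open>An \<open>indep_vars\<close> family shares one value type, hence three real variables in
  a list; the number of jumps will enter as a real.\<close>

lemma (in prob_space) prob_indep_vars_triple:
  fixes U V W :: "'a \<Rightarrow> real"
  assumes ind: "indep_vars (\<lambda>_. borel) (\<lambda>l. [U, V, W] ! l) {0, 1, 2}"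
    and A: "A \<in> sets borel" and B: "B \<in> sets borel" and C: "C \<in> sets borel"
  shows "\<P>(\<omega> in M. U \<omega> \<in> A \<and> V \<omega> \<in> B \<and> W \<omega> \<in> C)
    = \<P>(\<omega> in M. U \<omega> \<in> A) * \<P>(\<omega> in M. V \<omega> \<in> B) * \<P>(\<omega> in M. W \<omega> \<in> C)"
proof -
  let ?X = "\<lambda>l. [U, V, W] ! l" and ?A = "\<lambda>l. [A, B, C] ! l"
  have vimage: "f -` D \<inter> space M = {\<omega> \<in> space M. f \<omega> \<in> D}" for f :: "'a \<Rightarrow> real" and D
    by auto
  have "prob (\<Inter>l\<in>{0, 1, 2}. ?X l -` ?A l \<inter> space M) = (\<Prod>l\<in>{0, 1, 2}. prob (?X l -` ?A l \<inter> space M))"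
    by (rule indep_varsD[OF ind]) (use A B C in auto)
  moreover have "(\<Inter>l\<in>{0, 1, 2}. ?X l -` ?A l \<inter> space M)
      = {\<omega> \<in> space M. U \<omega> \<in> A \<and> V \<omega> \<in> B \<and> W \<omega> \<in> C}"
    by auto
  ultimately show ?thesis by (simp add: vimage mult.assoc)
qed

text \<open>Conditionally on \<open>P X = y\<close>, one step of the scheme is a Gaussian mixture over the number
  of jumps.\<close>

lemma (in prob_space) prob_mixture_step:
  fixes J :: "'a \<Rightarrow> nat" and \<xi> X :: "'a \<Rightarrow> real" and c s :: "nat \<Rightarrow> real \<Rightarrow> real"
  assumes J[measurable]: "J \<in> measurable M (count_space UNIV)"
    and J1: "\<P>(\<omega> in M. J \<omega> = 1) = q" and J0: "\<P>(\<omega> in M. J \<omega> = 0) = 1 - q"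
    and \<xi>: "distributed M lborel \<xi> std_normal_density"
    and X[measurable]: "X \<in> borel_measurable M"
    and ind: "indep_vars (\<lambda>_. borel) (\<lambda>l. [\<lambda>\<omega>. real (J \<omega>), \<xi>, X] ! l) {0, 1, 2}"
    and P[measurable]: "P \<in> borel_measurable borel"
    and C[measurable]: "C \<in> sets borel"
  shows "{\<omega> \<in> space M. c (J \<omega>) (P (X \<omega>)) + s (J \<omega>) (P (X \<omega>)) * \<xi> \<omega> \<in> C \<and> P (X \<omega>) = y} \<in> events"
      (is "?E \<in> _")
    and "\<P>(\<omega> in M. c (J \<omega>) (P (X \<omega>)) + s (J \<omega>) (P (X \<omega>)) * \<xi> \<omega> \<in> C \<and> P (X \<omega>) = y)
    = \<P>(\<omega> in M. P (X \<omega>) = y) *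
      ((1 - q) * measure std_normal_distribution {z. c 0 y + s 0 y * z \<in> C}
       + q * measure std_normal_distribution {z. c 1 y + s 1 y * z \<in> C})"
proof -
  have \<xi>_meas[measurable]: "\<xi> \<in> borel_measurable M"
    using distributed_measurable[OF \<xi>] by simp
  define S where "S m = {z. c m y + s m y * z \<in> C}" for m
  have S[measurable]: "S m \<in> sets borel" for m
    unfolding S_def by measurable
  \<comment> \<open>With J and P X fixed, the coefficients are constants and the event splits into
    one condition on each of the three independent variables.\<close>
  define F where "F m = {\<omega> \<in> space M. J \<omega> = m \<and> \<xi> \<omega> \<in> S m \<and> P (X \<omega>) = y}" for m
  have F[measurable]: "F m \<in> events" for m
    unfolding F_def by measurable
  \<comment> \<open>Measurability of \<open>?E\<close> comes from this countable union, as
    \<open>c\<close> and \<open>s\<close> are arbitrary functions.\<close>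
  have E_eq: "?E = (\<Union>m. F m)"
    by (auto simp: F_def S_def)
  show E[measurable]: "?E \<in> events"
    unfolding E_eq by (intro sets.countable_UN) auto
  have prob_\<xi>: "\<P>(\<omega> in M. \<xi> \<omega> \<in> S m) = measure std_normal_distribution (S m)" for m
  proof -
    have "measure std_normal_distribution (S m) = measure (distr M lborel \<xi>) (S m)"
      using \<xi> by (simp add: distributed_distr_eq_density)
    also have "\<dots> = \<P>(\<omega> in M. \<xi> \<omega> \<in> S m)"
      by (subst measure_distr) (auto intro!: arg_cong[where f=prob])
    finally show ?thesis by simp
  qed
  have prob_F: "prob (F m) = \<P>(\<omega> in M. J \<omega> = m) * measure std_normal_distribution (S m)
      * \<P>(\<omega> in M. P (X \<omega>) = y)" for m
  proof -
    have Py: "P -` {y} \<in> sets borel"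
      using measurable_sets[OF P, of "{y}"] by simp
    show ?thesis
      using prob_indep_vars_triple[OF ind, of "{real m}" "S m" "P -` {y}"] Py S
      by (simp add: F_def prob_\<xi>)
  qed
  \<comment> \<open>The two given probabilities add up to 1, so J is almost surely 0 or 1 and all
    other \<open>F m\<close> are negligible.\<close>
  have "prob {\<omega> \<in> space M. J \<omega> = 0 \<or> J \<omega> = 1}
      = prob ({\<omega> \<in> space M. J \<omega> = 0} \<union> {\<omega> \<in> space M. J \<omega> = 1})"
    by (intro arg_cong[where f=prob]) auto
  also have "\<dots> = 1"
    using J0 J1 by (subst finite_measure_Union) auto
  finally have "AE \<omega> in M. J \<omega> = 0 \<or> J \<omega> = 1"
    using AE_prob_1 by fastforce
  then have "prob ?E = prob (F 0 \<union> F 1)"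
    by (intro finite_measure_eq_AE) (auto simp: F_def S_def)
  also have "\<dots> = prob (F 0) + prob (F 1)"
    by (rule finite_measure_Union) (auto simp: F_def)
  finally show "prob ?E = \<P>(\<omega> in M. P (X \<omega>) = y) *
      ((1 - q) * measure std_normal_distribution {z. c 0 y + s 0 y * z \<in> C}
       + q * measure std_normal_distribution {z. c 1 y + s 1 y * z \<in> C})"
    unfolding prob_F J0 J1 S_def by (simp add: algebra_simps)
qed

section \<open>Transition and marginal probabilities on the grids\<close>

theorem proposition4p1:
  fixes M :: "'a measure"
    and T h lam \<mu> \<theta> :: real
    and n k N N' :: nat
    and b \<sigma> :: "real \<Rightarrow> real \<Rightarrow> real"
    and \<gamma> :: "real \<Rightarrow> real"
    and x x' :: "nat \<Rightarrow> real"
    and P P' :: "real \<Rightarrow> real"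
    and J :: "'a \<Rightarrow> nat"
    and \<xi> X Xhat X' :: "'a \<Rightarrow> real"
    and p :: "nat \<Rightarrow> real"
  assumes "prob_space M"
    and "h > 0" and "lam > 0" and "lam * h < 1" and "\<theta> \<ge> 0"
    and "k < n" and "real n * h \<le> T"
    and "inj_on x {1..N}"
    and "strict_mono_on {1..N'} x'"
    and "nearest_proj (x ` {1..N}) P"
    and "nearest_proj (x' ` {1..N'}) P'"
    and "\<And>m i. m \<in> {0, 1} \<Longrightarrow> i \<in> {1..N} \<Longrightarrow> step_sd \<sigma> \<gamma> \<theta> h k m (x i) > 0"
    and "J \<in> measurable M (count_space UNIV)"
    and "\<P>(\<omega> in M. J \<omega> = 1) = lam * h"
    and "\<P>(\<omega> in M. J \<omega> = 0) = 1 - lam * h"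
    and "distributed M lborel \<xi> std_normal_density"
    and "X \<in> borel_measurable M"
    and "prob_space.indep_vars M (\<lambda>_. borel) (\<lambda>l. [\<lambda>\<omega>. real (J \<omega>), \<xi>, X] ! l) {0, 1, 2}"
    and "Xhat = (\<lambda>\<omega>. P (X \<omega>))"
    and "X' = (\<lambda>\<omega>. step_mean b \<gamma> \<mu> lam h k (J \<omega>) (Xhat \<omega>)
                     + step_sd \<sigma> \<gamma> \<theta> h k (J \<omega>) (Xhat \<omega>) * \<xi> \<omega>)"
    and "p = (\<lambda>i. \<P>(\<omega> in M. Xhat \<omega> = x i))"
  shows "(\<forall>i\<in>{1..N}. \<forall>j\<in>{1..N'}. p i > 0 \<longrightarrow>
            \<P>(\<omega> in M. X' \<omega> \<in> voronoi_cell P' x' j \<bar> X \<omega> \<in> voronoi_cell P x i)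
            = (\<Sum>m=0..1. jump_prob lam h m *
                (Phi0 (standardize (upper_mid N' x' j)
                         (step_mean b \<gamma> \<mu> lam h k m (x i)) (step_sd \<sigma> \<gamma> \<theta> h k m (x i)))
               - Phi0 (standardize (lower_mid x' j)
                         (step_mean b \<gamma> \<mu> lam h k m (x i)) (step_sd \<sigma> \<gamma> \<theta> h k m (x i))))))
       \<and> (\<forall>j\<in>{1..N'}.
            \<P>(\<omega> in M. X' \<omega> \<in> voronoi_cell P' x' j)
            = (\<Sum>i=1..N. \<Sum>m=0..1. p i * jump_prob lam h m *
                (Phi0 (standardize (upper_mid N' x' j)
                         (step_mean b \<gamma> \<mu> lam h k m (x i)) (step_sd \<sigma> \<gamma> \<theta> h k m (x i)))
               - Phi0 (standardize (lower_mid x' j)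
                         (step_mean b \<gamma> \<mu> lam h k m (x i)) (step_sd \<sigma> \<gamma> \<theta> h k m (x i))))))"
proof -
  interpret prob_space M by fact
  note Xhat = \<open>Xhat = (\<lambda>\<omega>. P (X \<omega>))\<close> and X' = \<open>X' = (\<lambda>\<omega>. _ \<omega> + _ \<omega>)\<close>
    and p = \<open>p = (\<lambda>i. \<P>(\<omega> in M. Xhat \<omega> = x i))\<close>
  note P = \<open>nearest_proj (x ` {1..N}) P\<close> and P' = \<open>nearest_proj (x' ` {1..N'}) P'\<close>
  define D where "D m i j =
      Phi0 (standardize (upper_mid N' x' j)
              (step_mean b \<gamma> \<mu> lam h k m (x i)) (step_sd \<sigma> \<gamma> \<theta> h k m (x i)))
    - Phi0 (standardize (lower_mid x' j)
              (step_mean b \<gamma> \<mu> lam h k m (x i)) (step_sd \<sigma> \<gamma> \<theta> h k m (x i)))" for m i j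
  have P_meas: "P \<in> borel_measurable borel"
    using P by (simp add: nearest_proj_def)
  note mixture = prob_mixture_step[OF assms(13-18) P_meas voronoi_cell_measurable[OF P'],
      where c = "step_mean b \<gamma> \<mu> lam h k" and s = "step_sd \<sigma> \<gamma> \<theta> h k"]
  have ev: "{\<omega> \<in> space M. X' \<omega> \<in> voronoi_cell P' x' j \<and> Xhat \<omega> = x i} \<in> events" for i j
    unfolding X' Xhat by (rule mixture(1))
  \<comment> \<open>In this product form the identity also holds when \<open>p i\<close> is 0, so it
    can be summed over all i as well as divided by a positive \<open>p i\<close>.\<close>
  have joint: "\<P>(\<omega> in M. X' \<omega> \<in> voronoi_cell P' x' j \<and> Xhat \<omega> = x i)
      = p i * (\<Sum>m=0..1. jump_prob lam h m * D m i j)"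
    if i: "i \<in> {1..N}" and j: "j \<in> {1..N'}" for i j
  proof -
    have "measure std_normal_distribution
        {z. step_mean b \<gamma> \<mu> lam h k m (x i) + step_sd \<sigma> \<gamma> \<theta> h k m (x i) * z \<in> voronoi_cell P' x' j}
        = D m i j" if "m \<in> {0, 1}" for m
      unfolding D_def
      by (rule measure_std_normal_voronoi_cell[OF \<open>strict_mono_on {1..N'} x'\<close> P' j assms(12)[OF that i]])
    from this[of 0] this[of 1] show ?thesis
      unfolding X' Xhat p mixture(2) by (simp add: jump_prob_def)
  qed
  have "\<P>(\<omega> in M. X' \<omega> \<in> voronoi_cell P' x' j \<bar> X \<omega> \<in> voronoi_cell P x i)
      = (\<Sum>m=0..1. jump_prob lam h m * D m i j)"
    if "i \<in> {1..N}" "j \<in> {1..N'}" "p i > 0" for i j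
    \<comment> \<open>The conditioning event is \<open>Xhat\<close> = \<open>x i\<close>, of
      probability \<open>p i\<close>, which cancels.\<close>
    using joint[OF that(1,2)] that(3) by (simp add: cond_prob_def voronoi_cell_def Xhat p)
  moreover have "\<P>(\<omega> in M. X' \<omega> \<in> voronoi_cell P' x' j)
      = (\<Sum>i=1..N. \<Sum>m=0..1. p i * jump_prob lam h m * D m i j)"
    if j: "j \<in> {1..N'}" for j
  proof -
    let ?G = "\<lambda>i. {\<omega> \<in> space M. X' \<omega> \<in> voronoi_cell P' x' j \<and> Xhat \<omega> = x i}"
    have "Xhat \<omega> \<in> x ` {1..N}" for \<omega>
      using P by (simp add: Xhat nearest_proj_def)
    \<comment> \<open>The projection always lands in the grid, so the pieces cover the event with no
      null set left over.\<close>
    then have "{\<omega> \<in> space M. X' \<omega> \<in> voronoi_cell P' x' j} = (\<Union>i\<in>{1..N}. ?G i)"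
      by (auto simp: image_iff)
    then have "\<P>(\<omega> in M. X' \<omega> \<in> voronoi_cell P' x' j) = prob (\<Union>i\<in>{1..N}. ?G i)"
      by simp
    also have "\<dots> = (\<Sum>i\<in>{1..N}. prob (?G i))"
    proof (rule finite_measure_finite_Union)
      \<comment> \<open>Injectivity of the enumeration \<open>x\<close> prevents a grid point from
        being counted twice; the first grid need not be ordered.\<close>
      show "disjoint_family_on ?G {1..N}"
        unfolding disjoint_family_on_def
      proof (intro ballI impI)
        fix a c assume "a \<in> {1..N}" "c \<in> {1..N}" "a \<noteq> c"
        then have "x a \<noteq> x c"
          using \<open>inj_on x {1..N}\<close> by (meson inj_onD)
        then show "?G a \<inter> ?G c = {}" by auto
      qed
    qed (use ev in \<open>simp_all add: image_subset_iff\<close>)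
    also have "\<dots> = (\<Sum>i=1..N. \<Sum>m=0..1. p i * jump_prob lam h m * D m i j)"
      by (intro sum.cong refl) (simp only: joint[OF _ j] sum_distrib_left mult.assoc)
    finally show ?thesis .
  qed
  ultimately show ?thesis unfolding D_def by blast
qed

end
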